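(* Let $X$ be a finite non-empty set with $|X|=t$ and let $k\ge 1$ be an integer. The number of isomorphism classes of commuting incompressible families $\mathcal{F}=(f_1,\dots,f_k)$ of $k$ functions $X\to X$ is $$\sum_{1\le d_1\mid d_2\mid\cdots\mid d_{k-1}\mid t} d_1\cdot d_2\cdots d_{k-1},$$ the sum ranging over all chains of positive integers $d_1\mid d_2\mid\cdots\mid d_{k-1}\mid t$ (for $k=1$ the only chain is the empty one, contributing the empty product $1$).
   Context: Families are indexed tuples $(f_1,\dots,f_k)$ of functions $X\to X$ (repetitions allowed). A family is commuting if any two of its members commute under composition, and incompressible if there is no non-empty proper subset $J\subsetneq X$ with $f_i(J)\subseteq J$ for all $i$. Two families $(f_i)_{i=1}^k$ and $(g_i)_{i=1}^k$ are isomorphic if there is a permutation $\sigma$ of $X$ with $\sigma\circ f_i=g_i\circ\sigma$ for all $i$. *)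

theory Defs
  imports "HOL-Library.FuncSet" "HOL-Combinatorics.Permutations"
begin

text \<open>
  A family $(f_1,\dots,f_k)$ of functions $X \to X$ is a list of length \<open>k\<close>; its entries are
  extensional functions (\<open>undefined\<close> outside \<open>X\<close>), so that two families are equal iff they
  agree on \<open>X\<close> entrywise.
\<close>

definition families :: "'a set \<Rightarrow> nat \<Rightarrow> ('a \<Rightarrow> 'a) list set" where
  "families X k = {fs. length fs = k \<and> set fs \<subseteq> X \<rightarrow>\<^sub>E X}"

definition commuting :: "'a set \<Rightarrow> ('a \<Rightarrow> 'a) list \<Rightarrow> bool" where
  "commuting X fs \<longleftrightarrow> (\<forall>f \<in> set fs. \<forall>g \<in> set fs. \<forall>x \<in> X. f (g x) = g (f x))"

definition incompressible :: "'a set \<Rightarrow> ('a \<Rightarrow> 'a) list \<Rightarrow> bool" where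
  "incompressible X fs \<longleftrightarrow> \<not> (\<exists>J. J \<noteq> {} \<and> J \<subset> X \<and> (\<forall>f \<in> set fs. f ` J \<subseteq> J))"

definition isomorphic :: "'a set \<Rightarrow> ('a \<Rightarrow> 'a) list \<Rightarrow> ('a \<Rightarrow> 'a) list \<Rightarrow> bool" where
  "isomorphic X fs gs \<longleftrightarrow> length fs = length gs \<and>
     (\<exists>\<sigma>. \<sigma> permutes X \<and> (\<forall>i < length fs. \<forall>x \<in> X. \<sigma> ((fs ! i) x) = (gs ! i) (\<sigma> x)))"

definition comm_incomp_families :: "'a set \<Rightarrow> nat \<Rightarrow> ('a \<Rightarrow> 'a) list set" where
  "comm_incomp_families X k = {fs \<in> families X k. commuting X fs \<and> incompressible X fs}"

definition iso_rel :: "'a set \<Rightarrow> nat \<Rightarrow> (('a \<Rightarrow> 'a) list \<times> ('a \<Rightarrow> 'a) list) set" where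
  "iso_rel X k = {(fs, gs). fs \<in> comm_incomp_families X k \<and> gs \<in> comm_incomp_families X k \<and>
                            isomorphic X fs gs}"

text \<open>
  Chains $d_1 \mid \cdots \mid d_{k-1} \mid t$ of positive integers, as lists $[d_1,\dots,d_{k-1}]$
  not containing the final term \<open>t\<close>; for \<open>k = 1\<close> the only chain is the empty list.
\<close>

definition divisor_chains :: "nat \<Rightarrow> nat \<Rightarrow> nat list set" where
  "divisor_chains k t =
     {ds. length ds = k - 1 \<and> (\<forall>d \<in> set ds. 1 \<le> d) \<and> successively (dvd) (ds @ [t])}"

lemma isomorphic_refl: "isomorphic X fs fs"
  unfolding isomorphic_def by (auto intro!: exI[of _ id] permutes_id)

lemma isomorphic_sym:
  assumes "isomorphic X fs gs" and "set fs \<subseteq> X \<rightarrow>\<^sub>E X"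
  shows "isomorphic X gs fs"
proof -
  from assms(1) obtain s where len: "length fs = length gs" and s: "s permutes X"
    and eq: "\<And>i x. i < length fs \<Longrightarrow> x \<in> X \<Longrightarrow> s ((fs ! i) x) = (gs ! i) (s x)"
    unfolding isomorphic_def by blast
  have "inv s ((gs ! i) x) = (fs ! i) (inv s x)" if "i < length gs" "x \<in> X" for i x
  proof -
    have "inv s x \<in> X"
      using that permutes_in_image[OF permutes_inv[OF s]] by simp
    then have "s ((fs ! i) (inv s x)) = (gs ! i) x"
      using eq[of i "inv s x"] that len permutes_inverses(1)[OF s] by simp
    then show ?thesis
      by (metis permutes_inverses(2)[OF s])
  qed
  then show ?thesis
    unfolding isomorphic_def using len permutes_inv[OF s] by auto
qed

lemma isomorphic_trans:
  assumes "isomorphic X fs gs" and "isomorphic X gs hs"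
  shows "isomorphic X fs hs"
proof -
  from assms(1) obtain s where s: "length fs = length gs" "s permutes X"
    "\<And>i x. i < length fs \<Longrightarrow> x \<in> X \<Longrightarrow> s ((fs ! i) x) = (gs ! i) (s x)"
    unfolding isomorphic_def by blast
  from assms(2) obtain r where r: "length gs = length hs" "r permutes X"
    "\<And>i x. i < length gs \<Longrightarrow> x \<in> X \<Longrightarrow> r ((gs ! i) x) = (hs ! i) (r x)"
    unfolding isomorphic_def by blast
  have "(r \<circ> s) permutes X"
    using s(2) r(2) by (rule permutes_compose)
  moreover have "\<forall>i < length fs. \<forall>x \<in> X. (r \<circ> s) ((fs ! i) x) = (hs ! i) ((r \<circ> s) x)"
    using s r permutes_in_image[OF s(2)] by simp
  ultimately show ?thesis
    unfolding isomorphic_def using s(1) r(1) by (intro conjI exI[of _ "r \<circ> s"]) auto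
qed

lemma equiv_iso_rel: "equiv (comm_incomp_families X k) (iso_rel X k)"
proof (rule equivI)
  show "iso_rel X k \<subseteq> comm_incomp_families X k \<times> comm_incomp_families X k"
    unfolding iso_rel_def by blast
  show "refl_on (comm_incomp_families X k) (iso_rel X k)"
    unfolding refl_on_def iso_rel_def by (auto simp: isomorphic_refl)
  show "sym (iso_rel X k)"
    unfolding sym_def iso_rel_def
    by (auto simp: comm_incomp_families_def families_def intro: isomorphic_sym)
  show "trans (iso_rel X k)"
    unfolding trans_def iso_rel_def by (auto intro: isomorphic_trans)
qed

end

theory Submission
  imports Defs
begin

text \<open>
  Members of a commuting incompressible family are bijections, and an equivariant map between
  two such families is determined by its value at a single point, which can be prescribed freely
  when both families agree. Given a family \<open>g # gs\<close>, a minimal \<open>gs\<close>-invariant set \<open>Y\<close> of size \<open>d\<close>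
  is moved around cyclically by \<open>g\<close> through \<open>m = t / d\<close> disjoint copies that cover \<open>X\<close>, and \<open>g ^^ m\<close>
  acts on \<open>Y\<close> as one of the \<open>d\<close> maps commuting with \<open>gs\<close>. So the family is classified by a divisor
  \<open>d\<close> of \<open>t\<close>, an isomorphism class of families of \<open>k - 1\<close> functions on \<open>d\<close> points, and one of
  \<open>d\<close> choices. The resulting recursion \<open>N k t = (\<Sum>d | d dvd t. d * N (k - 1) d)\<close> is
  that of the sum over divisor chains, \<open>d\<close> being the last term of the chain.
\<close>

section \<open>Commuting incompressible families and equivariant maps between them\<close>

definition ci_family :: "'a set \<Rightarrow> ('a \<Rightarrow> 'a) list \<Rightarrow> bool" where
  "ci_family X fs \<longleftrightarrow> finite X \<and> X \<noteq> {} \<and> (\<forall>f \<in> set fs. f \<in> X \<rightarrow> X) \<and>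
     commuting X fs \<and> incompressible X fs"

text \<open>The two carriers may have different types, so that families on \<open>X\<close> can be
  compared with representatives on initial segments of the naturals.\<close>

definition equivariant :: "'a set \<Rightarrow> ('a \<Rightarrow> 'b) \<Rightarrow> ('a \<Rightarrow> 'a) list \<Rightarrow> ('b \<Rightarrow> 'b) list \<Rightarrow> bool" where
  "equivariant X e fs gs \<longleftrightarrow> list_all2 (\<lambda>f g. \<forall>x\<in>X. e (f x) = g (e x)) fs gs"

definition iso_families :: "'a set \<Rightarrow> ('a \<Rightarrow> 'a) list \<Rightarrow> 'b set \<Rightarrow> ('b \<Rightarrow> 'b) list \<Rightarrow> bool" where
  "iso_families X fs Y gs \<longleftrightarrow> (\<exists>e. bij_betw e X Y \<and> equivariant X e fs gs)"

lemma ci_family_whole: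
  assumes "ci_family X fs" "J \<subseteq> X" "J \<noteq> {}" "\<And>f x. f \<in> set fs \<Longrightarrow> x \<in> J \<Longrightarrow> f x \<in> J"
  shows "J = X"
  using assms unfolding ci_family_def incompressible_def by (metis image_subsetI psubsetI)

lemma ci_familyI:
  assumes "finite X" "X \<noteq> {}" "\<And>f x. f \<in> set fs \<Longrightarrow> x \<in> X \<Longrightarrow> f x \<in> X"
    and "\<And>f g x. f \<in> set fs \<Longrightarrow> g \<in> set fs \<Longrightarrow> x \<in> X \<Longrightarrow> f (g x) = g (f x)"
    and "\<And>J. J \<subseteq> X \<Longrightarrow> J \<noteq> {} \<Longrightarrow> (\<And>f x. f \<in> set fs \<Longrightarrow> x \<in> J \<Longrightarrow> f x \<in> J) \<Longrightarrow> J = X"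
  shows "ci_family X fs"
proof -
  have "\<not> J \<subset> X" if "J \<noteq> {}" "\<forall>f\<in>set fs. f ` J \<subseteq> J" for J
    using assms(5)[of J] that by blast
  then have "incompressible X fs" unfolding incompressible_def by blast
  then show ?thesis
    using assms(1-4) unfolding ci_family_def commuting_def by simp
qed

lemma ci_family_closed: "ci_family X fs \<Longrightarrow> f \<in> set fs \<Longrightarrow> x \<in> X \<Longrightarrow> f x \<in> X"
  unfolding ci_family_def by blast

lemma ci_family_commute:
  "ci_family X fs \<Longrightarrow> f \<in> set fs \<Longrightarrow> g \<in> set fs \<Longrightarrow> x \<in> X \<Longrightarrow> f (g x) = g (f x)"
  unfolding ci_family_def commuting_def by blast

text \<open>Commutation makes the image of \<open>f\<close> invariant under every member, so
  incompressibility forces it to be all of \<open>X\<close>; finiteness turns surjectivity into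
  injectivity.\<close>

lemma ci_family_bij_betw:
  assumes "ci_family X fs" "f \<in> set fs"
  shows "bij_betw f X X"
proof -
  have "f ` X = X"
  proof (rule ci_family_whole[OF assms(1)])
    show "f ` X \<subseteq> X" "f ` X \<noteq> {}"
      using assms unfolding ci_family_def by auto
    fix g y assume g: "g \<in> set fs" and "y \<in> f ` X"
    then obtain x where "x \<in> X" "y = f x" by blast
    then show "g y \<in> f ` X"
      using ci_family_commute[OF assms(1) g assms(2)] ci_family_closed[OF assms(1) g] by simp
  qed
  moreover have "finite X" using assms(1) unfolding ci_family_def by blast
  ultimately show ?thesis
    by (simp add: bij_betw_def eq_card_imp_inj_on)
qed

text \<open>The points where \<open>h\<close> and \<open>h'\<close> agree form an invariant set,
  which is non-empty because it contains \<open>a\<close>.\<close>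

lemma equivariant_eq:
  assumes ci: "ci_family X fs" and "equivariant X h fs gs" "equivariant X h' fs gs"
    and "a \<in> X" "h a = h' a" and "x \<in> X"
  shows "h x = h' x"
proof -
  have "{x \<in> X. h x = h' x} = X"
  proof (rule ci_family_whole[OF ci])
    fix f x assume f: "f \<in> set fs" and "x \<in> {x \<in> X. h x = h' x}"
    then have x: "x \<in> X" "h x = h' x" by auto
    obtain i where i: "i < length fs" "f = fs ! i" using f by (metis in_set_conv_nth)
    have "h (f x) = (gs ! i) (h x)" "h' (f x) = (gs ! i) (h' x)"
      using assms(2,3) i x unfolding equivariant_def list_all2_conv_all_nth by auto
    then show "f x \<in> {x \<in> X. h x = h' x}"
      using x f ci_family_closed[OF ci] by auto
  qed (use assms in auto)
  then show ?thesis using assms by blast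
qed

text \<open>Since \<open>g (e x) = e (f x)\<close>, the image of \<open>e\<close> is invariant under
  the target family, which is incompressible.\<close>

lemma equivariant_surj:
  assumes "ci_family Y gs" "equivariant X e fs gs" "e ` X \<subseteq> Y" "X \<noteq> {}"
    and cl: "\<And>f x. f \<in> set fs \<Longrightarrow> x \<in> X \<Longrightarrow> f x \<in> X"
  shows "e ` X = Y"
proof (rule ci_family_whole[OF assms(1)])
  fix g y assume "g \<in> set gs" "y \<in> e ` X"
  then obtain i x where i: "i < length gs" "g = gs ! i" and x: "x \<in> X" "y = e x"
    by (metis in_set_conv_nth image_iff)
  have l: "length fs = length gs" and "e ((fs ! i) x) = g y"
    using assms(2) i x unfolding equivariant_def list_all2_conv_all_nth by auto
  then show "g y \<in> e ` X"
    using cl[of "fs ! i" x] i x by (metis image_eqI nth_mem)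
qed (use assms in auto)

lemma equivariant_id: "equivariant X (\<lambda>x. x) fs fs"
  unfolding equivariant_def by (simp add: list_all2_same)

lemma equivariant_comp:
  assumes "equivariant X e fs gs" "equivariant Y e' gs hs" "e ` X \<subseteq> Y"
  shows "equivariant X (e' \<circ> e) fs hs"
  using assms unfolding equivariant_def list_all2_conv_all_nth by (auto simp: image_subset_iff)

lemma equivariant_inv_into:
  assumes "equivariant X e fs gs" "bij_betw e X Y"
    and cl: "\<And>f x. f \<in> set fs \<Longrightarrow> x \<in> X \<Longrightarrow> f x \<in> X"
  shows "equivariant Y (inv_into X e) gs fs"
  unfolding equivariant_def list_all2_conv_all_nth
proof (intro conjI allI impI ballI)
  show l: "length gs = length fs"
    using assms(1) unfolding equivariant_def by (simp add: list_all2_lengthD)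
  fix i y assume i: "i < length gs" and y: "y \<in> Y"
  define x where "x = inv_into X e y"
  have x: "x \<in> X" "e x = y"
    using assms(2) y unfolding x_def
    by (auto simp: bij_betw_def inv_into_into f_inv_into_f)
  have "e ((fs ! i) x) = (gs ! i) y"
    using assms(1) i x unfolding equivariant_def list_all2_conv_all_nth by auto
  moreover have "(fs ! i) x \<in> X" using cl i l x by simp
  ultimately show "inv_into X e ((gs ! i) y) = (fs ! i) (inv_into X e y)"
    using assms(2) unfolding x_def[symmetric] by (metis bij_betw_inv_into_left)
qed

lemma iso_families_refl: "iso_families X fs X fs"
  unfolding iso_families_def
  by (rule exI[of _ "\<lambda>x. x"]) (simp add: equivariant_id bij_betw_def)

lemma iso_families_trans:
  assumes "iso_families X fs Y gs" "iso_families Y gs Z hs"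
  shows "iso_families X fs Z hs"
proof -
  obtain e e' where e: "bij_betw e X Y" "equivariant X e fs gs"
    and e': "bij_betw e' Y Z" "equivariant Y e' gs hs"
    using assms unfolding iso_families_def by blast
  have "equivariant X (e' \<circ> e) fs hs"
    using e(2) e'(2) by (rule equivariant_comp) (simp add: bij_betw_imp_surj_on[OF e(1)])
  then show ?thesis
    using bij_betw_trans[OF e(1) e'(1)] unfolding iso_families_def by blast
qed

lemma iso_families_sym:
  assumes "iso_families X fs Y gs" "\<And>f x. f \<in> set fs \<Longrightarrow> x \<in> X \<Longrightarrow> f x \<in> X"
  shows "iso_families Y gs X fs"
proof -
  obtain e where e: "bij_betw e X Y" "equivariant X e fs gs"
    using assms(1) unfolding iso_families_def by blast
  have "equivariant Y (inv_into X e) gs fs"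
    using e(2,1) assms(2) by (rule equivariant_inv_into)
  then show ?thesis
    using bij_betw_inv_into[OF e(1)] unfolding iso_families_def by blast
qed

section \<open>Translations: the maps commuting with a family\<close>

text \<open>The possible images of \<open>a\<close> form an invariant set: following an equivariant
  map by a member \<open>g\<close> gives another one, because \<open>g\<close> commutes with the
  family. Together with \<open>equivariant_eq\<close> this yields exactly one commuting self-map for
  each target \<open>b\<close>, hence the factor \<open>d\<close> in the recursion.\<close>

lemma ex_translation:
  assumes ci: "ci_family X fs" and "a \<in> X" "b \<in> X"
  shows "\<exists>\<phi>. \<phi> \<in> X \<rightarrow> X \<and> (\<forall>f\<in>set fs. \<forall>x\<in>X. \<phi> (f x) = f (\<phi> x)) \<and> \<phi> a = b"
proof -
  let ?J = "{b \<in> X. \<exists>\<phi>. \<phi> \<in> X \<rightarrow> X \<and> (\<forall>f\<in>set fs. \<forall>x\<in>X. \<phi> (f x) = f (\<phi> x)) \<and> \<phi> a = b}"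
  have "?J = X"
  proof (rule ci_family_whole[OF ci])
    have "a \<in> ?J" using assms by (auto intro!: exI[of _ "\<lambda>x. x"])
    then show "?J \<noteq> {}" by blast
    fix g y assume g: "g \<in> set fs" and y: "y \<in> ?J"
    then obtain \<phi> where p: "\<phi> \<in> X \<rightarrow> X" "\<forall>f\<in>set fs. \<forall>x\<in>X. \<phi> (f x) = f (\<phi> x)" "\<phi> a = y"
      by blast
    have gp: "(\<lambda>x. g (\<phi> x)) \<in> X \<rightarrow> X" using p(1) ci_family_closed[OF ci g] by blast
    moreover from gp have "\<forall>f\<in>set fs. \<forall>x\<in>X. g (\<phi> (f x)) = f (g (\<phi> x))"
      using p g ci_family_commute[OF ci] by (metis PiE)
    ultimately show "g y \<in> ?J"
      using p gp g y ci_family_closed[OF ci g] by blast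
  qed blast
  then show ?thesis using assms by blast
qed

text \<open>For a commuting incompressible family and points \<open>a\<close>, \<open>b\<close> of
  \<open>X\<close>, the values on \<open>X\<close> are forced by \<open>equivariant_eq\<close>;
  \<open>SOME\<close> leaves freedom only outside \<open>X\<close>.\<close>

definition translation :: "'a set \<Rightarrow> ('a \<Rightarrow> 'a) list \<Rightarrow> 'a \<Rightarrow> 'a \<Rightarrow> 'a \<Rightarrow> 'a" where
  "translation X fs a b =
     (SOME \<phi>. \<phi> \<in> X \<rightarrow> X \<and> (\<forall>f\<in>set fs. \<forall>x\<in>X. \<phi> (f x) = f (\<phi> x)) \<and> \<phi> a = b)"

lemma translation:
  assumes "ci_family X fs" "a \<in> X" "b \<in> X"
  shows translation_closed: "x \<in> X \<Longrightarrow> translation X fs a b x \<in> X"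
    and translation_commute:
      "f \<in> set fs \<Longrightarrow> x \<in> X \<Longrightarrow> translation X fs a b (f x) = f (translation X fs a b x)"
    and translation_base: "translation X fs a b a = b"
  using someI_ex[OF ex_translation[OF assms]] unfolding translation_def[symmetric] by auto

lemma equivariant_translation:
  assumes "ci_family X fs" "a \<in> X" "b \<in> X"
  shows "equivariant X (translation X fs a b) fs fs"
  using translation_commute[OF assms] unfolding equivariant_def list_all2_conv_all_nth by simp

text \<open>Any isomorphism can be followed by the translation of \<open>Y\<close> that takes
  \<open>e a\<close> to \<open>b\<close>.\<close>

lemma iso_families_pointed:
  assumes "iso_families X fs Y gs" "ci_family X fs" "ci_family Y gs" "a \<in> X" "b \<in> Y"
  obtains e where "bij_betw e X Y" "equivariant X e fs gs" "e a = b"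
proof -
  obtain e where e: "bij_betw e X Y" "equivariant X e fs gs"
    using assms unfolding iso_families_def by blast
  let ?\<phi> = "translation Y gs (e a) b"
  have a: "e a \<in> Y" using e assms(4) bij_betwE by blast
  have "?\<phi> ` Y = Y"
    using assms(3) equivariant_translation[OF assms(3) a assms(5)]
      translation_closed[OF assms(3) a assms(5)] ci_family_closed[OF assms(3)] assms(5)
    by (intro equivariant_surj) auto
  moreover have "finite Y" using assms(3) unfolding ci_family_def by blast
  ultimately have "bij_betw ?\<phi> Y Y" by (simp add: bij_betw_def eq_card_imp_inj_on)
  then have "bij_betw (?\<phi> \<circ> e) X Y" using e by (blast intro: bij_betw_trans)
  moreover have "equivariant X (?\<phi> \<circ> e) fs gs"
    using e equivariant_translation[OF assms(3) a assms(5)]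
    by (blast intro: equivariant_comp dest: bij_betw_imp_surj_on)
  moreover have "(?\<phi> \<circ> e) a = b" using translation_base[OF assms(3) a assms(5)] by simp
  ultimately show ?thesis by (rule that)
qed

subsection \<open>Extending a family by one cyclic generator\<close>

text \<open>
  The number \<open>q * d + r\<close> with \<open>r < d\<close> stands for the point \<open>r\<close> in the \<open>q\<close>-th of \<open>m\<close> copies of
  \<open>{..<d}\<close>; the map \<open>\<phi>\<close> is the twist picked up on returning to the first copy.
\<close>

definition block_shift :: "nat \<Rightarrow> nat \<Rightarrow> (nat \<Rightarrow> nat) \<Rightarrow> nat \<Rightarrow> nat" where
  "block_shift d m \<phi> x = (if Suc (x div d) < m then x + d else \<phi> (x mod d))"

definition block_lift :: "nat \<Rightarrow> (nat \<Rightarrow> nat) \<Rightarrow> nat \<Rightarrow> nat" where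
  "block_lift d f x = x div d * d + f (x mod d)"

definition extension :: "nat \<Rightarrow> nat \<Rightarrow> (nat \<Rightarrow> nat) \<Rightarrow> (nat \<Rightarrow> nat) list \<Rightarrow> (nat \<Rightarrow> nat) list" where
  "extension d m \<phi> F = block_shift d m \<phi> # map (block_lift d) F"

lemma block_cases:
  fixes x d m :: nat
  assumes "x < d * m"
  obtains q r where "x = q * d + r" "q < m" "r < d"
proof (rule that[of "x div d" "x mod d"])
  show "x div d < m" using assms by (simp add: less_mult_imp_div_less mult.commute)
  show "x mod d < d" using assms by (cases "d = 0") auto
qed simp

lemma block_less:
  fixes q r d m :: nat
  assumes "q < m" "r < d"
  shows "q * d + r < d * m"
proof -
  have "q * d + r < Suc q * d" using assms by simp
  also have "\<dots> \<le> m * d" using assms by (intro mult_right_mono) auto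
  finally show ?thesis by (simp add: mult.commute)
qed

lemma block_shift_eq:
  "r < d \<Longrightarrow> block_shift d m \<phi> (q * d + r) = (if Suc q < m then Suc q * d + r else \<phi> r)"
  unfolding block_shift_def by simp

lemma block_lift_eq: "r < d \<Longrightarrow> block_lift d f (q * d + r) = q * d + f r"
  unfolding block_lift_def by simp

text \<open>The new map commutes with the lifts because the twist \<open>\<phi>\<close> commutes
  with \<open>F\<close>. For incompressibility, an invariant set that meets a block contains it, and
  the shift spreads it to the later blocks and around to the first.\<close>

lemma ci_family_extension:
  assumes ci: "ci_family {..<d} F" and m: "m > 0"
    and p: "\<And>x. x < d \<Longrightarrow> \<phi> x < d"
    and pc: "\<And>f x. f \<in> set F \<Longrightarrow> x < d \<Longrightarrow> \<phi> (f x) = f (\<phi> x)"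
  shows "ci_family {..<d * m} (extension d m \<phi> F)"
proof -
  have d: "d > 0" using ci unfolding ci_family_def by auto
  have Fc: "f x < d" if "f \<in> set F" "x < d" for f x
    using ci_family_closed[OF ci] that by auto
  have sl: "block_shift d m \<phi> (block_lift d f x) = block_lift d f (block_shift d m \<phi> x)"
    if "f \<in> set F" "x < d * m" for f x
    using that(2)
  proof (rule block_cases)
    fix q r assume x: "x = q * d + r" "q < m" "r < d"
    show ?thesis
      using x Fc[OF that(1), of r] pc[OF that(1), of r] p[of r]
        block_lift_eq[of "\<phi> r" d f 0] block_lift_eq[of r d f "Suc q"]
      by (simp add: block_shift_eq block_lift_eq)
  qed
  have ll: "block_lift d f (block_lift d g x) = block_lift d g (block_lift d f x)"
    if "f \<in> set F" "g \<in> set F" "x < d * m" for f g x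
    using that(3)
  proof (rule block_cases)
    fix q r assume x: "x = q * d + r" "q < m" "r < d"
    then show ?thesis
      using Fc that ci_family_commute[OF ci, of f g r] by (simp add: block_lift_eq)
  qed
  show ?thesis
  proof (rule ci_familyI)
    show "{..<d * m} \<noteq> {}" using d m by (simp add: lessThan_empty_iff)
  next
    fix f x assume f: "f \<in> set (extension d m \<phi> F)" and "x \<in> {..<d * m}"
    then have "x < d * m" by simp
    then show "f x \<in> {..<d * m}"
    proof (rule block_cases)
      fix q r assume x: "x = q * d + r" "q < m" "r < d"
      have "block_shift d m \<phi> x < d * m"
        using x block_less[of "Suc q" m r d] block_less[of 0 m "\<phi> r" d] m p[of r]
        by (simp add: block_shift_eq)
      moreover have "block_lift d g x < d * m" if "g \<in> set F" for g
        using x Fc[OF that] block_less[of q m "g r" d] by (simp add: block_lift_eq)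
      ultimately show ?thesis using f unfolding extension_def by auto
    qed
  next
    fix f g x assume "f \<in> set (extension d m \<phi> F)" "g \<in> set (extension d m \<phi> F)" "x \<in> {..<d * m}"
    then show "f (g x) = g (f x)" unfolding extension_def by (auto simp: sl ll)
  next
    fix J assume J: "J \<subseteq> {..<d * m}" "J \<noteq> {}"
      "\<And>f x. f \<in> set (extension d m \<phi> F) \<Longrightarrow> x \<in> J \<Longrightarrow> f x \<in> J"
    \<comment> \<open>On each block the lifts act as \<open>F\<close> does, so the trace of
      \<open>J\<close> on the block is \<open>F\<close>-invariant.\<close>
    have full: "\<forall>r<d. q * d + r \<in> J" if "r < d" "q * d + r \<in> J" for q r
    proof -
      have "{r. r < d \<and> q * d + r \<in> J} = {..<d}"
      proof (rule ci_family_whole[OF ci])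
        fix f x assume fx: "f \<in> set F" "x \<in> {r. r < d \<and> q * d + r \<in> J}"
        then have "block_lift d f (q * d + x) \<in> J"
          using J(3)[of "block_lift d f"] by (auto simp: extension_def)
        then show "f x \<in> {r. r < d \<and> q * d + r \<in> J}"
          using fx Fc by (simp add: block_lift_eq)
      qed (use that in auto)
      then show ?thesis by blast
    qed
    have sh: "block_shift d m \<phi> x \<in> J" if "x \<in> J" for x
      using that J(3)[of "block_shift d m \<phi>"] by (simp add: extension_def)
    \<comment> \<open>It suffices to push the starting point of a block one block further;
      \<open>full\<close> then fills the new block.\<close>
    have up: "\<forall>r<d. q' * d + r \<in> J" if "\<forall>r<d. q * d + r \<in> J" "q \<le> q'" "q' < m" for q q'
      using that(2,3,1)
    proof (induction q' rule: dec_induct)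
      case (step n)
      then have "n * d + 0 \<in> J" using d Suc_lessD by blast
      from sh[OF this] have "Suc n * d + 0 \<in> J"
        using step.prems(1) block_shift_eq[OF d, of m \<phi> n] by simp
      then show ?case using full[of 0 "Suc n"] d by blast
    qed
    obtain x where x: "x \<in> J" using J by blast
    then have "x < d * m" using J by blast
    then obtain q r where "x = q * d + r" "q < m" "r < d" by (rule block_cases)
    with full x have "\<forall>r<d. q * d + r \<in> J" by blast
    moreover have "q \<le> m - 1" "m - 1 < m" using \<open>q < m\<close> by auto
    ultimately have "\<forall>r<d. (m - 1) * d + r \<in> J" by (rule up)
    then have "(m - 1) * d + 0 \<in> J" using d by blast
    \<comment> \<open>Block \<open>m - 1\<close> is the last one, so here the shift returns to block
      0 through \<open>\<phi>\<close>.\<close>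
    from sh[OF this] have "0 * d + \<phi> 0 \<in> J" using d m by (simp add: block_shift_def)
    then have "\<forall>r<d. 0 * d + r \<in> J" using full p d by blast
    then have all: "\<forall>r<d. q * d + r \<in> J" if "q < m" for q using up[of 0 q] that by blast
    show "J = {..<d * m}"
    proof
      show "{..<d * m} \<subseteq> J"
      proof
        fix x assume "x \<in> {..<d * m}"
        then have "x < d * m" by simp
        then show "x \<in> J" by (rule block_cases) (use all in blast)
      qed
    qed (rule J)
  qed simp
qed

section \<open>Every non-empty family is isomorphic to an extension\<close>

text \<open>Take a non-empty \<open>gs\<close>-invariant subset of least cardinality: an invariant
  non-empty subset of it cannot be smaller.\<close>

lemma ex_ci_subset:
  assumes ci: "ci_family X (g # gs)"
  shows "\<exists>Y\<subseteq>X. ci_family Y gs"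
proof -
  let ?P = "\<lambda>Y. Y \<subseteq> X \<and> Y \<noteq> {} \<and> (\<forall>f\<in>set gs. \<forall>x\<in>Y. f x \<in> Y)"
  have fin: "finite X" using ci unfolding ci_family_def by blast
  have "?P X" using ci unfolding ci_family_def by auto
  then have "\<exists>Y. ?P Y \<and> (\<forall>Z. ?P Z \<longrightarrow> card Y \<le> card Z)"
    by (rule ex_has_least_nat)
  then obtain Y where Y: "?P Y" and least: "\<And>Z. ?P Z \<Longrightarrow> card Y \<le> card Z"
    by (elim exE conjE) metis
  have "ci_family Y gs"
  proof (rule ci_familyI)
    show fY: "finite Y" using Y fin finite_subset by blast
    show "f (h x) = h (f x)" if "f \<in> set gs" "h \<in> set gs" "x \<in> Y" for f h x
      using ci_family_commute[OF ci, of f h x] that Y by auto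
    fix J assume J: "J \<subseteq> Y" "J \<noteq> {}" "\<And>f x. f \<in> set gs \<Longrightarrow> x \<in> J \<Longrightarrow> f x \<in> J"
    then have "card Y \<le> card J" using Y by (intro least) blast
    then show "J = Y" using J fY by (simp add: card_seteq)
  qed (use Y in auto)
  then show ?thesis using Y by blast
qed

text \<open>The blocks correspond to the images of \<open>Y\<close> under \<open>g ^^ q\<close> for
  \<open>q < m\<close>, where \<open>m\<close> is the first return time to \<open>Y\<close>;
  \<open>c\<close> is the coordinate at which the point \<open>e 0\<close> returns.\<close>

lemma iso_families_extension:
  assumes ci: "ci_family X (g # gs)" and YX: "Y \<subseteq> X" and ciY: "ci_family Y gs"
    and ciF: "ci_family {..<d} F" and iso: "iso_families {..<d} F Y gs"
  obtains m c where "m > 0" "card X = d * m" "c < d"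
    "iso_families {..<d * m} (extension d m (translation {..<d} F 0 c) F) X (g # gs)"
proof -
  have d: "d > 0" using ciF unfolding ci_family_def by auto
  have fin: "finite X" using ci unfolding ci_family_def by blast
  obtain e where e: "bij_betw e {..<d} Y" "equivariant {..<d} e F gs"
    using iso unfolding iso_families_def by blast
  have eY: "e r \<in> Y" if "r < d" for r using e that bij_betwE by blast
  have gX: "g x \<in> X" if "x \<in> X" for x using ci_family_closed[OF ci] that by simp
  have powX: "(g ^^ n) x \<in> X" if "x \<in> X" for n x
    by (induction n) (use gX that in auto)
  have "bij_betw g X X" using ci_family_bij_betw[OF ci] by simp
  then have bij: "bij_betw (g ^^ n) X X" for n by (rule bij_betw_funpow)
  have powc: "(g ^^ n) (f x) = f ((g ^^ n) x)" if "f \<in> set gs" "x \<in> X" for n f x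
  proof (induction n)
    case (Suc n)
    then show ?case
      using ci_family_commute[OF ci, of g f "(g ^^ n) x"] that powX by simp
  qed simp
  have cancel: "(g ^^ n) x = y" if "(g ^^ (i + n)) x = (g ^^ i) y" "x \<in> X" "y \<in> X" for i n x y
  proof -
    have "(g ^^ i) ((g ^^ n) x) = (g ^^ i) y" using that by (simp add: funpow_add)
    then show ?thesis
      using bij[of i] powX that unfolding bij_betw_def inj_on_def by blast
  qed
  \<comment> \<open>minimal invariant sets meet only if equal, so the first return of one point is that of all of \<open>Y\<close>\<close>
  let ?Q = "\<lambda>n. n > 0 \<and> (\<exists>y\<in>Y. (g ^^ n) y \<in> Y)"
  have "\<exists>n. ?Q n"
  proof -
    have y: "e 0 \<in> Y" using eY d by simp
    \<comment> \<open>An injective orbit would be an infinite subset of the finite set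
      \<open>X\<close>. Two equal iterates then give a positive period, since powers of
      \<open>g\<close> can be cancelled.\<close>
    have "\<not> inj (\<lambda>n. (g ^^ n) (e 0))"
      using finite_subset[OF _ fin, of "range (\<lambda>n. (g ^^ n) (e 0))"] powX y YX
      by (metis (no_types, lifting) image_subset_iff finite_imageD infinite_UNIV_nat subsetD)
    then obtain i j where ij: "(g ^^ i) (e 0) = (g ^^ j) (e 0)" "i < j"
      unfolding inj_on_def by (metis linorder_neqE_nat UNIV_I)
    then have "(g ^^ (j - i)) (e 0) = e 0" using cancel[of i "j - i" "e 0" "e 0"] y YX by auto
    then have "?Q (j - i)" using ij y by (metis zero_less_diff)
    then show ?thesis by blast
  qed
  moreover define m where "m = (LEAST n. ?Q n)"
  ultimately have m: "?Q m"
    using LeastI_ex[of ?Q] by simp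
  have least: "m \<le> n" if "?Q n" for n
    unfolding m_def using that by (rule Least_le)
  have "{y \<in> Y. (g ^^ m) y \<in> Y} = Y"
  proof (rule ci_family_whole[OF ciY])
    fix f x assume "f \<in> set gs" "x \<in> {y \<in> Y. (g ^^ m) y \<in> Y}"
    then show "f x \<in> {y \<in> Y. (g ^^ m) y \<in> Y}"
      using powc YX ci_family_closed[OF ciY] by auto
  qed (use m in auto)
  then have mY: "(g ^^ m) y \<in> Y" if "y \<in> Y" for y using that by blast
  then have "(g ^^ m) (e 0) \<in> e ` {..<d}" using eY d e by (simp add: bij_betw_def)
  then obtain c where c: "c < d" "(g ^^ m) (e 0) = e c" by auto
  let ?\<phi> = "translation {..<d} F 0 c"
  have p: "?\<phi> x < d" if "x < d" for x
    using translation_closed[OF ciF, of 0 c x] that c d by simp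
  have pe: "equivariant {..<d} ?\<phi> F F" using equivariant_translation[OF ciF] c d by simp
  \<comment> \<open>In coordinates the return map is the translation by \<open>c\<close>: both sides
    are equivariant from \<open>F\<close> to \<open>gs\<close> and agree at 0.\<close>
  have wrap: "(g ^^ m) (e r) = e (?\<phi> r)" if "r < d" for r
  proof -
    have "equivariant {..<d} (e \<circ> ?\<phi>) F gs"
      using pe e(2) p by (intro equivariant_comp[where Y = "{..<d}"]) auto
    moreover have "equivariant Y (g ^^ m) gs gs"
      using powc YX unfolding equivariant_def list_all2_same by blast
    then have "equivariant {..<d} ((g ^^ m) \<circ> e) F gs"
      using e(2) eY by (intro equivariant_comp) auto
    ultimately have "((g ^^ m) \<circ> e) r = (e \<circ> ?\<phi>) r"
      using c d that translation_base[OF ciF, of 0 c]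
        equivariant_eq[OF ciF, of "(g ^^ m) \<circ> e" gs "e \<circ> ?\<phi>" 0 r] by simp
    then show ?thesis by simp
  qed
  have ciE: "ci_family {..<d * m} (extension d m ?\<phi> F)"
    using m p translation_commute[OF ciF, of 0 c] c d by (intro ci_family_extension[OF ciF]) auto
  \<comment> \<open>Point \<open>r\<close> of block \<open>q\<close> goes to the \<open>q\<close>-th
    \<open>g\<close>-iterate of the point of \<open>Y\<close> with coordinate
    \<open>r\<close>.\<close>
  define E where "E x = (g ^^ (x div d)) (e (x mod d))" for x
  have E: "E (q * d + r) = (g ^^ q) (e r)" if "r < d" for q r
    using that unfolding E_def by simp
  have EX: "E ` {..<d * m} \<subseteq> X"
    unfolding E_def using d eY YX powX by (auto intro!: powX)
  have "E (block_shift d m ?\<phi> x) = g (E x)" if "x < d * m" for x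
    using that
  proof (rule block_cases)
    fix q r assume x: "x = q * d + r" "q < m" "r < d"
    show ?thesis
    proof (cases "Suc q < m")
      case True
      then show ?thesis using x E[of r q] E[of r "Suc q"] by (simp add: block_shift_eq)
    next
      \<comment> \<open>In the last block one more application of \<open>g\<close> completes
        \<open>g ^^ m\<close>, and \<open>wrap\<close> matches it with the twist.\<close>
      case False
      then have mq: "m = Suc q" using x by simp
      then show ?thesis
        using x E[of r q] E[of "?\<phi> r" 0] wrap[of r] p[of r] by (simp add: block_shift_eq mq)
    qed
  qed
  moreover have "list_all2 (\<lambda>f g. \<forall>x\<in>{..<d * m}. E (block_lift d f x) = g (E x)) F gs"
    unfolding list_all2_conv_all_nth
  proof (intro conjI allI impI ballI)
    show l: "length F = length gs"
      using e unfolding equivariant_def by (simp add: list_all2_lengthD)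
    fix i x assume i: "i < length F" and "x \<in> {..<d * m}"
    then have "x < d * m" by simp
    then show "E (block_lift d (F ! i) x) = (gs ! i) (E x)"
    proof (rule block_cases)
      fix q r assume x: "x = q * d + r" "q < m" "r < d"
      have "(F ! i) r < d" using ci_family_closed[OF ciF, of "F ! i" r] i x by simp
      moreover have "e ((F ! i) r) = (gs ! i) (e r)"
        using e(2) i x unfolding equivariant_def list_all2_conv_all_nth by simp
      moreover have "(g ^^ q) ((gs ! i) (e r)) = (gs ! i) ((g ^^ q) (e r))"
        using powc[of "gs ! i" "e r" q] i l x eY YX by auto
      ultimately show ?thesis
        using x E[of r q] E[of "(F ! i) r" q] by (simp add: block_lift_eq)
    qed
  qed
  ultimately have Ee: "equivariant {..<d * m} E (extension d m ?\<phi> F) (g # gs)"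
    unfolding equivariant_def extension_def by (simp add: list_all2_map1)
  have "E ` {..<d * m} = X"
    using ci_family_closed[OF ciE] m d EX
    by (intro equivariant_surj[OF ci Ee]) (auto simp: lessThan_empty_iff)
  \<comment> \<open>A coincidence between blocks \<open>q\<close> and \<open>q'\<close> would be a
    return to \<open>Y\<close> after \<open>q' - q < m\<close> steps, so minimality of
    \<open>m\<close> leaves only \<open>q = q'\<close>.\<close>
  moreover have eq: "q = q' \<and> r = r'"
    if "(g ^^ q) (e r) = (g ^^ q') (e r')" "q \<le> q'" "q' < m" "r < d" "r' < d" for q q' r r'
  proof -
    have "(g ^^ (q' - q)) (e r') = e r"
      using cancel[of q "q' - q" "e r'" "e r"] that eY YX by auto
    then have "q' = q" using least[of "q' - q"] that eY by (metis diff_is_0_eq less_imp_diff_less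
      not_less order_antisym_conv bot_nat_0.not_eq_extremum)
    then have "e r' = e r" using \<open>(g ^^ (q' - q)) (e r') = e r\<close> by simp
    then show ?thesis
      using \<open>q' = q\<close> that e(1) unfolding bij_betw_def inj_on_def by auto
  qed
  have "inj_on E {..<d * m}"
  proof (rule inj_onI)
    fix x x' assume "x \<in> {..<d * m}" "x' \<in> {..<d * m}" and Exx: "E x = E x'"
    then have "x < d * m" "x' < d * m" by auto
    then obtain q r q' r' where x: "x = q * d + r" "q < m" "r < d"
      and x': "x' = q' * d + r'" "q' < m" "r' < d"
      by (metis block_cases)
    have "(g ^^ q) (e r) = (g ^^ q') (e r')" using Exx x x' E by simp
    then have "q = q' \<and> r = r'"
      using eq[of q r q' r'] eq[of q' r' q r] x x' by (metis nat_le_linear)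
    then show "x = x'" using x x' by simp
  qed
  ultimately have Eb: "bij_betw E {..<d * m} X" by (simp add: bij_betw_def)
  show ?thesis
  proof (rule that)
    show "m > 0" using m by blast
    show "card X = d * m" using bij_betw_same_card[OF Eb] by simp
    show "c < d" by (rule c)
    show "iso_families {..<d * m} (extension d m ?\<phi> F) X (g # gs)"
      using Eb Ee unfolding iso_families_def by blast
  qed
qed

section \<open>Recovering the data of an extension from its isomorphism class\<close>

text \<open>An isomorphism normalised to fix 0 must match the first blocks, which gives
  \<open>d\<close> and the class of \<open>F\<close>; once \<open>F = F'\<close> it is the identity
  there, and following the shift once around compares the twists.\<close>

lemma iso_extensionD:
  assumes ciF: "ci_family {..<d} F" and ciF': "ci_family {..<d'} F'"
    and c: "c < d" "c' < d'" and t: "d * m = d' * m'" "m > 0"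
    and iso: "iso_families {..<d * m} (extension d m (translation {..<d} F 0 c) F)
                {..<d' * m'} (extension d' m' (translation {..<d'} F' 0 c') F')"
  shows "d = d'" "iso_families {..<d} F {..<d} F'" "F = F' \<Longrightarrow> c = c'"
proof -
  let ?\<phi> = "translation {..<d} F 0 c" and ?\<phi>' = "translation {..<d'} F' 0 c'"
  have d: "d > 0" "d' > 0" using c by auto
  have m': "m' > 0" using t d by (cases m') auto
  have dm: "d \<le> d * m" "d' \<le> d' * m'" using t(2) m' by simp_all
  have ci: "ci_family {..<d * m} (extension d m ?\<phi> F)"
    using t translation_closed[OF ciF, of 0 c] translation_commute[OF ciF, of 0 c] c d
    by (intro ci_family_extension[OF ciF]) auto
  have ci': "ci_family {..<d' * m'} (extension d' m' ?\<phi>' F')"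
    using m' translation_closed[OF ciF', of 0 c'] translation_commute[OF ciF', of 0 c'] c d
    by (intro ci_family_extension[OF ciF']) auto
  have zero: "0 \<in> {..<d * m}" "0 \<in> {..<d' * m'}" using d t m' by auto
  obtain s where s: "bij_betw s {..<d * m} {..<d' * m'}"
    "equivariant {..<d * m} s (extension d m ?\<phi> F) (extension d' m' ?\<phi>' F')" "s 0 = 0"
    by (rule iso_families_pointed[OF iso ci ci' zero])
  have shift: "s (block_shift d m ?\<phi> x) = block_shift d' m' ?\<phi>' (s x)" if "x < d * m" for x
    using s(2) that unfolding equivariant_def extension_def by simp
  have l: "length F = length F'"
    using s(2) unfolding equivariant_def extension_def by (auto dest: list_all2_lengthD)
  have Fd: "(F ! i) x < d" if "x < d" "i < length F" for i x
    using ci_family_closed[OF ciF, of "F ! i" x] that by simp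
  have lift: "s ((F ! i) x) = block_lift d' (F' ! i) (s x)" if "x < d" "i < length F" for x i
  proof -
    have "list_all2 (\<lambda>f g. \<forall>x\<in>{..<d * m}. s (block_lift d f x) = block_lift d' g (s x)) F F'"
      using s(2) unfolding equivariant_def extension_def
      by (simp add: list_all2_map1 list_all2_map2)
    from list_all2_nthD[OF this, of i]
    have "s (block_lift d (F ! i) x) = block_lift d' (F' ! i) (s x)"
      using that less_le_trans[OF that(1) dm(1)] by blast
    then show ?thesis using that by (simp add: block_lift_def)
  qed
  \<comment> \<open>Lifts preserve blocks, so the points of the first block that \<open>s\<close>
    keeps in the first block form an \<open>F\<close>-invariant set containing 0.\<close>
  have "{x \<in> {..<d}. s x < d'} = {..<d}"
  proof (rule ci_family_whole[OF ciF])
    show "{x \<in> {..<d}. s x < d'} \<noteq> {}" using d s(3) by auto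
    fix f x assume f: "f \<in> set F" and x: "x \<in> {x \<in> {..<d}. s x < d'}"
    obtain i where i: "f = F ! i" "i < length F" using f by (metis in_set_conv_nth)
    have "(F' ! i) (s x) < d'" using ci_family_closed[OF ciF', of "F' ! i" "s x"] i l x by simp
    then show "f x \<in> {x \<in> {..<d}. s x < d'}"
      using i x lift[of x i] Fd[of x i] by (simp add: block_lift_def)
  qed blast
  then have sd: "s x < d'" if "x < d" for x using that by blast
  have es: "equivariant {..<d} s F F'"
    unfolding equivariant_def list_all2_conv_all_nth using l lift sd by (simp add: block_lift_def)
  have "s ` {..<d} = {..<d'}"
    using sd d ci_family_closed[OF ciF] by (intro equivariant_surj[OF ciF' es]) auto
  moreover have "inj_on s {..<d}"
    using s(1) dm unfolding bij_betw_def by (metis inj_on_subset lessThan_subset_iff)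
  ultimately have bs: "bij_betw s {..<d} {..<d'}" by (simp add: bij_betw_def)
  show dd: "d = d'" using bij_betw_same_card[OF bs] by simp
  show "iso_families {..<d} F {..<d} F'" using bs es dd unfolding iso_families_def by blast
  have mm: "m = m'" using dd t d by simp
  assume FF: "F = F'"
  have sid: "s x = x" if "x < d" for x
    using equivariant_eq[OF ciF, of s F "\<lambda>x. x" 0 x] es FF s(3) d that equivariant_id by auto
  \<comment> \<open>The starting points of the blocks are the successive shifts of 0, and
    \<open>s\<close> respects the shift.\<close>
  have sq: "s (q * d) = q * d" if "q < m" for q
    using that
  proof (induction q)
    case (Suc q)
    have "q * d < d * m" using block_less[of q m 0 d] Suc d by simp
    from shift[OF this] show ?case
      using Suc d mm dd block_shift_eq[of 0 d m _ q] by simp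
  qed (use s in simp)
  \<comment> \<open>Shifting the start of the last block lands on the twist of 0, which is
    \<open>c\<close> on one side and \<open>c'\<close> on the other.\<close>
  have "(m - 1) * d < d * m" using block_less[of "m - 1" m 0 d] t d by simp
  from shift[OF this] have "s c = c'"
    using sq[of "m - 1"] t d mm dd block_shift_eq[of 0 d m _ "m - 1"]
      translation_base[OF ciF, of 0 c] translation_base[OF ciF', of 0 c'] c by simp
  then show "c = c'" using sid c by simp
qed

subsection \<open>Representatives of the isomorphism classes\<close>

text \<open>One family on \<open>{..<t}\<close> for each isomorphism class, intended for
  \<open>t > 0\<close>. In the base case the empty family leaves every subset invariant, so it is
  incompressible only on one point.\<close>

fun reps :: "nat \<Rightarrow> nat \<Rightarrow> (nat \<Rightarrow> nat) list set" where
  "reps 0 t = (if t = 1 then {[]} else {})"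
| "reps (Suc k) t = (\<lambda>(d, F, c). extension d (t div d) (translation {..<d} F 0 c) F) `
     (SIGMA d : {d. d dvd t}. reps k d \<times> {..<d})"

lemma reps_ci_family:
  assumes "t > 0" "F \<in> reps k t"
  shows "ci_family {..<t} F \<and> length F = k"
  using assms
proof (induction k arbitrary: t F)
  case 0
  then have "t = 1" "F = []" by (auto split: if_splits)
  then show ?case by (auto intro!: ci_familyI)
next
  case (Suc k)
  then obtain d G c where d: "d dvd t" "G \<in> reps k d" "c < d"
    and F: "F = extension d (t div d) (translation {..<d} G 0 c) G" by auto
  have ciG: "ci_family {..<d} G" "length G = k" using Suc.IH[of d G] d by auto
  have "ci_family {..<d * (t div d)} F"
    unfolding F using d Suc.prems(1) translation_closed[OF ciG(1), of 0 c]
      translation_commute[OF ciG(1), of 0 c]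
    by (intro ci_family_extension[OF ciG(1)]) (auto simp: div_greater_zero_iff dvd_imp_le)
  then show ?case using d ciG F by (simp add: extension_def)
qed

text \<open>Induction on the family with \<open>X\<close> arbitrary, because the tail is classified
  on the smaller set \<open>Y\<close>.\<close>

lemma ex_rep:
  assumes "ci_family X fs"
  shows "\<exists>F \<in> reps (length fs) (card X). iso_families {..<card X} F X fs"
  using assms
proof (induction fs arbitrary: X)
  case Nil
  then obtain x where x: "x \<in> X" unfolding ci_family_def by blast
  then have X: "{x} = X" by (intro ci_family_whole[OF Nil]) auto
  have "iso_families {..<card X} [] X []"
    unfolding iso_families_def equivariant_def X[symmetric]
    by (auto intro!: exI[of _ "\<lambda>_. x"] simp: bij_betw_def lessThan_Suc)
  moreover have "card X = 1" using X by auto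
  ultimately show ?case by simp
next
  case (Cons g gs)
  obtain Y where Y: "Y \<subseteq> X" "ci_family Y gs" using ex_ci_subset[OF Cons.prems] by blast
  let ?d = "card Y"
  obtain F where F: "F \<in> reps (length gs) ?d" "iso_families {..<?d} F Y gs"
    using Cons.IH[OF Y(2)] by blast
  have "?d > 0" using Y(2) unfolding ci_family_def by (simp add: card_gt_0_iff)
  then have ciF: "ci_family {..<?d} F" using F reps_ci_family by blast
  obtain m c where m: "m > 0" "card X = ?d * m" "c < ?d"
    "iso_families {..<?d * m} (extension ?d m (translation {..<?d} F 0 c) F) X (g # gs)"
    by (rule iso_families_extension[OF Cons.prems Y ciF F(2)])
  have "extension ?d m (translation {..<?d} F 0 c) F \<in> reps (Suc (length gs)) (card X)"
    using m F \<open>?d > 0\<close> by (auto intro!: image_eqI[where x = "(?d, F, c)"])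
  then show ?case using m(2,4) by (metis length_Cons)
qed

lemma reps_iso_eq_and_inj:
  assumes "t > 0"
  shows "\<forall>F\<in>reps k t. \<forall>G\<in>reps k t. iso_families {..<t} F {..<t} G \<longrightarrow> F = G"
    and "inj_on (\<lambda>(d, F, c). extension d (t div d) (translation {..<d} F 0 c) F)
           (SIGMA d : {d. d dvd t}. reps k d \<times> {..<d})"
proof -
  \<comment> \<open>The uniqueness for \<open>k\<close> is a premise, so this serves both the
    induction step below and the injectivity claim, where equal extensions are isomorphic by the
    identity.\<close>
  have same: "(d, F, c) = (d', F', c')"
    if IH: "\<forall>n>0. \<forall>F\<in>reps k n. \<forall>G\<in>reps k n. iso_families {..<n} F {..<n} G \<longrightarrow> F = G"
      and t: "t > 0" and d: "d dvd t" "d' dvd t"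
      and F: "F \<in> reps k d" "F' \<in> reps k d'" and c: "c < d" "c' < d'"
      and iso: "iso_families {..<t} (extension d (t div d) (translation {..<d} F 0 c) F)
                  {..<t} (extension d' (t div d') (translation {..<d'} F' 0 c') F')"
    for k t d d' :: nat and F F' c c'
  proof -
    have ci: "ci_family {..<d} F" "ci_family {..<d'} F'"
      using reps_ci_family F c by fastforce+
    have dt: "d * (t div d) = t" "d' * (t div d') = t" using d by auto
    have "t div d > 0" using d t c by (simp add: div_greater_zero_iff dvd_imp_le)
    note * = iso_extensionD[OF ci c, of "t div d" "t div d'", unfolded dt, OF refl this iso]
    have "F = F'" using *(1,2) IH F c by (metis gr_zeroI less_nat_zero_code)
    then show ?thesis using *(1,3) by blast
  qed
  have iso_eq: "F = G" if "t > 0" "F \<in> reps k t" "G \<in> reps k t" "iso_families {..<t} F {..<t} G"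
    for k t F G
    using that
  proof (induction k arbitrary: t F G)
    case 0
    then show ?case by (auto split: if_splits)
  next
    case (Suc k t F H)
    obtain d G c where F: "d dvd t" "G \<in> reps k d" "c < d"
      "F = extension d (t div d) (translation {..<d} G 0 c) G" using Suc.prems(2) by auto
    obtain d' G' c' where G: "d' dvd t" "G' \<in> reps k d'" "c' < d'"
      "H = extension d' (t div d') (translation {..<d'} G' 0 c') G'" using Suc.prems(3) by auto
    have "\<forall>n>0. \<forall>F\<in>reps k n. \<forall>G\<in>reps k n. iso_families {..<n} F {..<n} G \<longrightarrow> F = G"
      using Suc.IH by blast
    from same[OF this Suc.prems(1) F(1) G(1) F(2) G(2) F(3) G(3)] have "(d, G, c) = (d', G', c')"
      using F(4) G(4) Suc.prems(4) by blast
    then show ?case using F(4) G(4) by blast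
  qed
  then show "\<forall>F\<in>reps k t. \<forall>G\<in>reps k t. iso_families {..<t} F {..<t} G \<longrightarrow> F = G"
    using assms by blast
  show "inj_on (\<lambda>(d, F, c). extension d (t div d) (translation {..<d} F 0 c) F)
          (SIGMA d : {d. d dvd t}. reps k d \<times> {..<d})"
  proof (rule inj_onI)
    fix p p'
    assume "p \<in> (SIGMA d : {d. d dvd t}. reps k d \<times> {..<d})"
      and "p' \<in> (SIGMA d : {d. d dvd t}. reps k d \<times> {..<d})"
      and peq: "(\<lambda>(d, F, c). extension d (t div d) (translation {..<d} F 0 c) F) p =
        (\<lambda>(d, F, c). extension d (t div d) (translation {..<d} F 0 c) F) p'"
    then obtain d F c d' F' c' where p: "p = (d, F, c)" "p' = (d', F', c')"
      and *: "d dvd t" "d' dvd t" "F \<in> reps k d" "F' \<in> reps k d'" "c < d" "c' < d'"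
      by auto
    have eq: "extension d (t div d) (translation {..<d} F 0 c) F =
               extension d' (t div d') (translation {..<d'} F' 0 c') F'"
      using peq p by simp
    have "\<forall>n>0. \<forall>F\<in>reps k n. \<forall>G\<in>reps k n. iso_families {..<n} F {..<n} G \<longrightarrow> F = G"
      using iso_eq by blast
    from same[OF this assms *(1-4)] show "p = p'"
      using p *(5,6) iso_families_refl[of "{..<t}"] eq by simp
  qed
qed

lemma finite_reps: "t > 0 \<Longrightarrow> finite (reps k t)"
proof (induction k arbitrary: t)
  case (Suc k)
  have "finite (reps k d \<times> {..<d})" if "d dvd t" for d
    using Suc.IH dvd_pos_nat[OF Suc.prems that] by simp
  moreover have "finite {d. d dvd t}" using Suc.prems by simp
  ultimately have "finite (SIGMA d : {d. d dvd t}. reps k d \<times> {..<d})"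
    by (rule finite_SigmaI[rotated]) simp
  then show ?case by simp
qed simp

lemma card_reps_Suc:
  assumes "t > 0"
  shows "card (reps (Suc k) t) = (\<Sum>d | d dvd t. card (reps k d) * d)"
proof -
  have "finite (reps k d \<times> {..<d})" if "d dvd t" for d
    using finite_reps assms that by (simp add: dvd_pos_nat)
  then show ?thesis
    unfolding reps.simps card_image[OF reps_iso_eq_and_inj(2)[OF assms]] using assms
    by (subst card_SigmaI) (auto simp: card_cartesian_product)
qed

section \<open>Divisor chains and the common recursion\<close>

text \<open>Splitting off the last term \<open>d\<close> leaves a chain whose end point is
  \<open>d\<close> instead of \<open>t\<close>. A chain for \<open>k\<close> functions has
  \<open>k - 1\<close> terms, so a last term exists from two functions on.\<close>

lemma divisor_chains_Suc_Suc:
  "divisor_chains (Suc (Suc k)) t =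
     (\<lambda>(d, ds). ds @ [d]) ` (SIGMA d : {d. 1 \<le> d \<and> d dvd t}. divisor_chains (Suc k) d)"
proof (intro equalityI subsetI)
  fix ds assume ds: "ds \<in> divisor_chains (Suc (Suc k)) t"
  then have "length ds = Suc k" unfolding divisor_chains_def by simp
  then obtain es d where e: "ds = es @ [d]" by (metis length_Suc_conv_rev)
  have "d \<ge> 1 \<and> d dvd t \<and> es \<in> divisor_chains (Suc k) d"
    using ds unfolding divisor_chains_def e by (auto simp: successively_append_iff)
  then show "ds \<in> (\<lambda>(d, ds). ds @ [d]) ` (SIGMA d : {d. 1 \<le> d \<and> d dvd t}. divisor_chains (Suc k) d)"
    using e by (auto intro!: image_eqI[where x = "(d, es)"])
next
  fix ds assume "ds \<in> (\<lambda>(d, ds). ds @ [d]) ` (SIGMA d : {d. 1 \<le> d \<and> d dvd t}. divisor_chains (Suc k) d)"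
  then show "ds \<in> divisor_chains (Suc (Suc k)) t"
    unfolding divisor_chains_def by (auto simp: successively_append_iff)
qed

lemma divisor_chains_1: "divisor_chains (Suc 0) t = {[]}"
  unfolding divisor_chains_def by auto

lemma finite_divisor_chains: "t > 0 \<Longrightarrow> finite (divisor_chains (Suc k) t)"
proof (induction k arbitrary: t)
  case (Suc k)
  then have "finite (SIGMA d : {d. 1 \<le> d \<and> d dvd t}. divisor_chains (Suc k) d)"
    by (intro finite_SigmaI) auto
  then show ?case unfolding divisor_chains_Suc_Suc by (rule finite_imageI)
qed (simp add: divisor_chains_1)

lemma sum_divisor_chains_Suc_Suc:
  assumes "t > 0"
  shows "(\<Sum>ds\<in>divisor_chains (Suc (Suc k)) t. prod_list ds) =
    (\<Sum>d | d dvd t. (\<Sum>ds\<in>divisor_chains (Suc k) d. prod_list ds) * d)"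
proof -
  have D: "{d. 1 \<le> d \<and> d dvd t} = {d. d dvd t}" using assms by (auto simp: Suc_le_eq dvd_pos_nat)
  have "inj_on (\<lambda>(d, ds). ds @ [d]) (SIGMA d : {d. d dvd t}. divisor_chains (Suc k) d)"
    by (auto simp: inj_on_def)
  then have "(\<Sum>ds\<in>divisor_chains (Suc (Suc k)) t. prod_list ds) =
      (\<Sum>(d, ds)\<in>(SIGMA d : {d. d dvd t}. divisor_chains (Suc k) d). prod_list ds * d)"
    unfolding divisor_chains_Suc_Suc D
    by (subst sum.reindex) (auto intro!: sum.cong)
  also have "\<dots> = (\<Sum>d | d dvd t. \<Sum>ds\<in>divisor_chains (Suc k) d. prod_list ds * d)"
    using assms finite_divisor_chains by (subst sum.Sigma) (auto simp: dvd_pos_nat)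
  finally show ?thesis by (simp add: sum_distrib_right)
qed

text \<open>Both sides obey the same recursion over the divisors of \<open>t\<close>; with one
  function only \<open>d = 1\<close> contributes, which gives the 1 of the empty chain.\<close>

lemma card_reps:
  "t > 0 \<Longrightarrow> card (reps (Suc k) t) = (\<Sum>ds\<in>divisor_chains (Suc k) t. prod_list ds)"
proof (induction k arbitrary: t)
  case 0
  have "card (reps (Suc 0) t) = (\<Sum>d | d dvd t. if d = 1 then 1 else 0)"
    unfolding card_reps_Suc[OF 0] by (intro sum.cong) auto
  also have "\<dots> = 1" using 0 by (subst sum.delta) auto
  finally show ?case by (simp add: divisor_chains_1)
next
  case (Suc k)
  have "card (reps (Suc (Suc k)) t) = (\<Sum>d | d dvd t. card (reps (Suc k) d) * d)"
    by (rule card_reps_Suc[OF Suc.prems])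
  also have "\<dots> = (\<Sum>d | d dvd t. (\<Sum>ds\<in>divisor_chains (Suc k) d. prod_list ds) * d)"
    using Suc by (intro sum.cong) (auto simp: dvd_pos_nat simp del: reps.simps)
  also have "\<dots> = (\<Sum>ds\<in>divisor_chains (Suc (Suc k)) t. prod_list ds)"
    using sum_divisor_chains_Suc_Suc[OF Suc.prems] by simp
  finally show ?case .
qed

subsection \<open>Families on a given set\<close>

lemma comm_incomp_families_iff:
  assumes "finite X" "X \<noteq> {}"
  shows "fs \<in> comm_incomp_families X k \<longleftrightarrow>
    ci_family X fs \<and> length fs = k \<and> set fs \<subseteq> extensional X"
  using assms unfolding comm_incomp_families_def families_def ci_family_def
  by (auto simp: PiE_def)

lemma isomorphic_iff_iso_families:
  assumes cl: "\<And>f x. f \<in> set fs \<Longrightarrow> x \<in> X \<Longrightarrow> f x \<in> X"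
  shows "isomorphic X fs gs \<longleftrightarrow> iso_families X fs X gs"
proof
  assume "isomorphic X fs gs"
  then show "iso_families X fs X gs"
    unfolding isomorphic_def iso_families_def equivariant_def list_all2_conv_all_nth
    using permutes_imp_bij by blast
next
  assume "iso_families X fs X gs"
  then obtain e where e: "bij_betw e X X" "equivariant X e fs gs"
    unfolding iso_families_def by blast
  \<comment> \<open>A permutation of \<open>X\<close> in the sense of \<open>permutes\<close> must
    fix everything outside \<open>X\<close>.\<close>
  let ?s = "\<lambda>x. if x \<in> X then e x else x"
  have "bij_betw ?s X X" using e(1) by (simp cong: bij_betw_cong)
  then have s: "?s permutes X" by (rule bij_imp_permutes) auto
  moreover have "?s ((fs ! i) x) = (gs ! i) (?s x)" if "i < length fs" "x \<in> X" for i x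
    using e(2) that cl[of "fs ! i" x] unfolding equivariant_def list_all2_conv_all_nth by simp
  moreover have "length fs = length gs"
    using e(2) unfolding equivariant_def by (rule list_all2_lengthD)
  ultimately show "isomorphic X fs gs"
    unfolding isomorphic_def by blast
qed

lemma ci_family_transport:
  assumes ci: "ci_family Y F" and b: "bij_betw b Y X"
    and eq: "equivariant Y b F fs" and cl: "\<And>f x. f \<in> set fs \<Longrightarrow> x \<in> X \<Longrightarrow> f x \<in> X"
  shows "ci_family X fs"
proof -
  let ?c = "inv_into Y b"
  have c: "bij_betw ?c X Y" using b by (rule bij_betw_inv_into)
  have ceq: "equivariant X ?c fs F"
    using eq b ci_family_closed[OF ci] by (rule equivariant_inv_into)
  have F: "\<exists>g\<in>set F. \<forall>x\<in>X. ?c (f x) = g (?c x)" if "f \<in> set fs" for f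
    using ceq that unfolding equivariant_def list_all2_conv_all_nth by (metis in_set_conv_nth nth_mem)
  have F': "\<exists>g\<in>set fs. \<forall>y\<in>Y. b (f y) = g (b y)" if "f \<in> set F" for f
    using eq that unfolding equivariant_def list_all2_conv_all_nth by (metis in_set_conv_nth nth_mem)
  have cY: "?c x \<in> Y" "b (?c x) = x" if "x \<in> X" for x
    using b c that by (auto simp: bij_betwE bij_betw_inv_into_right)
  show ?thesis
  proof (rule ci_familyI)
    show "finite X" "X \<noteq> {}"
      using ci b bij_betw_finite unfolding ci_family_def by (blast, force simp: bij_betw_def)
  next
    fix f g x assume fg: "f \<in> set fs" "g \<in> set fs" and x: "x \<in> X"
    obtain f' g' where f': "f' \<in> set F" "\<forall>x\<in>X. ?c (f x) = f' (?c x)"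
      and g': "g' \<in> set F" "\<forall>x\<in>X. ?c (g x) = g' (?c x)"
      using F fg by metis
    have "?c (f (g x)) = ?c (g (f x))"
      using f' g' ci_family_commute[OF ci f'(1) g'(1)] cY x fg cl by simp
    then show "f (g x) = g (f x)" using cY(2) fg x cl by metis
  next
    fix J assume J: "J \<subseteq> X" "J \<noteq> {}" "\<And>f x. f \<in> set fs \<Longrightarrow> x \<in> J \<Longrightarrow> f x \<in> J"
    have "{y \<in> Y. b y \<in> J} = Y"
    proof (rule ci_family_whole[OF ci])
      obtain x where "x \<in> J" using J(2) by blast
      then have "inv_into Y b x \<in> {y \<in> Y. b y \<in> J}" using cY[of x] J(1) by auto
      then show "{y \<in> Y. b y \<in> J} \<noteq> {}" by blast
      show "f y \<in> {y \<in> Y. b y \<in> J}" if "f \<in> set F" "y \<in> {y \<in> Y. b y \<in> J}" for f y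
        using that F'[OF that(1)] J(3) ci_family_closed[OF ci that(1)] by auto
    qed blast
    then have "b ` Y \<subseteq> J" by blast
    then have "x \<in> J" if "x \<in> X" for x using cY[OF that] by (metis image_subset_iff)
    then show "J = X" using J(1) by blast
  qed (rule cl)
qed

text \<open>Conjugating by \<open>b\<close> moves a representative to \<open>X\<close>;
  \<open>restrict\<close> makes the entries extensional, as \<open>families\<close> demands.\<close>

lemma ex_extensional_copy:
  assumes ci: "ci_family Y F" and b: "bij_betw b Y X"
  shows "\<exists>fs \<in> comm_incomp_families X (length F). iso_families Y F X fs"
proof -
  define fs where "fs = map (\<lambda>f. restrict (\<lambda>x. b (f (inv_into Y b x))) X) F"
  have X: "finite X" "X \<noteq> {}"
    using ci b bij_betw_finite unfolding ci_family_def by (blast, force simp: bij_betw_def)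
  have bY: "b y \<in> X" "inv_into Y b (b y) = y" if "y \<in> Y" for y
    using b that by (auto simp: bij_betwE bij_betw_inv_into_left)
  have c: "inv_into Y b x \<in> Y" if "x \<in> X" for x
    using bij_betw_inv_into[OF b] that by (blast dest: bij_betwE)
  have eq: "equivariant Y b F fs"
    unfolding equivariant_def fs_def list_all2_conv_all_nth using bY by simp
  have "ci_family X fs"
    using ci b eq by (rule ci_family_transport)
      (use bY c ci_family_closed[OF ci] in \<open>auto simp: fs_def\<close>)
  moreover have "length fs = length F" "set fs \<subseteq> extensional X" unfolding fs_def by auto
  ultimately have "fs \<in> comm_incomp_families X (length F)"
    using comm_incomp_families_iff[OF X] by blast
  then show ?thesis using b eq unfolding iso_families_def by blast
qed

lemma card_iso_classes:
  assumes X: "finite X" "X \<noteq> {}"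
  shows "card (comm_incomp_families X k // iso_rel X k) = card (reps k (card X))"
proof -
  let ?t = "card X" and ?C = "comm_incomp_families X k" and ?R = "iso_rel X k"
  have t: "?t > 0" using X by (simp add: card_gt_0_iff)
  obtain b where b: "bij_betw b {..<?t} X"
    using ex_bij_betw_nat_finite[OF X(1)] by (auto simp: atLeast0LessThan)
  have C: "ci_family X fs" "length fs = k" if "fs \<in> ?C" for fs
    using that comm_incomp_families_iff[OF X] by auto
  have "\<exists>fs \<in> ?C. iso_families {..<?t} F X fs" if "F \<in> reps k ?t" for F
    using ex_extensional_copy[OF _ b, of F] reps_ci_family[OF t that] by auto
  then obtain \<Phi> where \<Phi>: "\<And>F. F \<in> reps k ?t \<Longrightarrow> \<Phi> F \<in> ?C \<and> iso_families {..<?t} F X (\<Phi> F)"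
    by metis
  have rel: "(fs, gs) \<in> ?R \<longleftrightarrow> iso_families X fs X gs" if "fs \<in> ?C" "gs \<in> ?C" for fs gs
    using that isomorphic_iff_iso_families[of fs X gs] ci_family_closed[OF C(1)[OF that(1)]]
    unfolding iso_rel_def by blast
  have sym: "iso_families X fs {..<?t} F" if "iso_families {..<?t} F X fs" "F \<in> reps k ?t" for F fs
    using that(1) ci_family_closed[OF reps_ci_family[OF t that(2), THEN conjunct1]]
    by (rule iso_families_sym)
  \<comment> \<open>Each representative is sent to the class of its copy on \<open>X\<close>.
    Injectivity is \<open>reps_iso_eq_and_inj\<close>, pulled back along the copies; surjectivity is
    \<open>ex_rep\<close>.\<close>
  have "bij_betw (\<lambda>F. ?R `` {\<Phi> F}) (reps k ?t) (?C // ?R)"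
    unfolding bij_betw_def
  proof (intro conjI inj_onI)
    fix F G assume FG: "F \<in> reps k ?t" "G \<in> reps k ?t" "?R `` {\<Phi> F} = ?R `` {\<Phi> G}"
    then have "(\<Phi> F, \<Phi> G) \<in> ?R"
      using \<Phi> eq_equiv_class_iff[OF equiv_iso_rel] by blast
    then have "iso_families X (\<Phi> F) X (\<Phi> G)" using rel \<Phi> FG by blast
    then have "iso_families {..<?t} F {..<?t} G"
      using \<Phi> FG sym iso_families_trans by metis
    then show "F = G" using reps_iso_eq_and_inj(1)[OF t] FG by blast
  next
    show "(\<lambda>F. ?R `` {\<Phi> F}) ` reps k ?t = ?C // ?R"
    proof (intro equalityI subsetI)
      fix c assume "c \<in> ?C // ?R"
      then obtain fs where fs: "fs \<in> ?C" "c = ?R `` {fs}" by (auto elim: quotientE)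
      obtain F where F: "F \<in> reps k ?t" "iso_families {..<?t} F X fs"
        using ex_rep[OF C(1)[OF fs(1)]] C(2)[OF fs(1)] by auto
      then have "iso_families X (\<Phi> F) X fs"
        using \<Phi> sym iso_families_trans by metis
      then have "(\<Phi> F, fs) \<in> ?R" using rel \<Phi> F fs by blast
      then have "?R `` {\<Phi> F} = ?R `` {fs}" by (rule equiv_class_eq[OF equiv_iso_rel])
      then show "c \<in> (\<lambda>F. ?R `` {\<Phi> F}) ` reps k ?t" using F fs by blast
    qed (use \<Phi> in \<open>auto intro: quotientI\<close>)
  qed
  then show ?thesis by (rule bij_betw_same_card[symmetric])
qed

theorem corollary2p8:
  fixes X :: "'a set" and t k :: nat
  assumes "finite X" and "X \<noteq> {}" and "card X = t" and "k \<ge> 1"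
  shows "card (comm_incomp_families X k // iso_rel X k) = (\<Sum>ds \<in> divisor_chains k t. prod_list ds)"
proof -
  obtain j where k: "k = Suc j" using assms(4) by (cases k) auto
  have "t > 0" using assms by (auto simp: card_gt_0_iff)
  then show ?thesis
    using card_iso_classes[OF assms(1,2), of k] card_reps[of t j] k assms(3) by simp
qed

end
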